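(* Let $m\geq 1$ be an integer and let $a,b\in\mathbb{C}$ satisfy $\frac{a+b+1}{2}\notin\{0,-1,-2,\ldots,1-m\}$. Then $$\sum_{k=0}^{m}\frac{(a)_{k}\,(b)_{k}\,(-m)_{k}}{k!\,\left(\frac{a+b+1}{2}\right)_{k}\,(-2m)_{k}}=\frac{\left(\frac{a+1}{2}\right)_{m}\left(\frac{b+1}{2}\right)_{m}}{\left(\frac{1}{2}\right)_{m}\left(\frac{a+b+1}{2}\right)_{m}}.$$
   Context: The Pochhammer symbol is defined for $t\in\mathbb{C}$ and integers $k\geq 0$ by $(t)_0=1$ and $(t)_{k+1}=(t)_k\,(t+k)$. *)

theory Defs
  imports Complex_Main
begin

end

theory Submission
  imports Defs
begin

text \<open>
  Write \<open>t m k\<close> for the summand and \<open>c = (a + b + 1) / 2\<close>. Gosper's algorithm finds that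
  \<open>t (m + 1) k - \<rho> t m k\<close>, where \<open>\<rho>\<close> is the quotient of consecutive right-hand sides, is the
  difference in \<open>k\<close> of a multiple of \<open>(a + k - 1) (b + k - 1) t m (k - 1)\<close>. Summation
  over \<open>k\<close> then shows that the left-hand side satisfies the same first-order recurrence in
  \<open>m\<close> as the right-hand side.
\<close>

definition watson_term :: "'a::field_char_0 \<Rightarrow> 'a \<Rightarrow> 'a \<Rightarrow> nat \<Rightarrow> nat \<Rightarrow> 'a" where
  "watson_term a b c m k =
     (pochhammer a k * pochhammer b k * pochhammer (- of_nat m) k) /
     (fact k * pochhammer c k * pochhammer (- 2 * of_nat m) k)"

lemma watson_term_0 [simp]: "watson_term a b c m 0 = 1"
  by (simp add: watson_term_def)

text \<open>Factors are only split off and none is cancelled, so the ratio also holds where a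
  denominator is 0, division by zero giving 0.\<close>

lemma watson_term_Suc_right:
  fixes a b c :: "'a::field_char_0"
  shows "watson_term a b c m (Suc k) = watson_term a b c m k *
     ((a + of_nat k) * (b + of_nat k) * (of_nat k - of_nat m) /
      (of_nat (Suc k) * (c + of_nat k) * (of_nat k - 2 * of_nat m)))"
proof -
  have "- of_nat m + of_nat k = (of_nat k - of_nat m :: 'a)"
    and "- 2 * of_nat m + of_nat k = (of_nat k - 2 * of_nat m :: 'a)"
    by simp_all
  then show ?thesis
    unfolding watson_term_def pochhammer_Suc fact_Suc by (simp add: mult_ac del: of_nat_Suc)
qed

text \<open>On the diagonal the Pochhammer bases can be matched: \<open>- (m + 1)\<close> moves to
  \<open>- m\<close> after one factor, \<open>- 2 * (m + 1)\<close> to \<open>- 2 * m\<close> after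
  two.\<close>

lemma watson_term_Suc_Suc:
  fixes a b c :: "'a::field_char_0"
  assumes "k \<le> m"
  shows "watson_term a b c (Suc m) (Suc k) = watson_term a b c m k *
     ((a + of_nat k) * (b + of_nat k) * (2 * of_nat m + 1 - of_nat k) /
      (2 * of_nat (Suc k) * (c + of_nat k) * (2 * of_nat m + 1)))"
proof -
  let ?M = "of_nat m :: 'a" and ?K = "of_nat k :: 'a"
  let ?P = "pochhammer (- 2 * of_nat m :: 'a) k"
  have num: "pochhammer (- of_nat (Suc m) :: 'a) (Suc k) = - (?M + 1) * pochhammer (- ?M) k"
    by (simp add: pochhammer_rec algebra_simps)
  \<comment> \<open>The length \<open>k + 2\<close> leaves \<open>k\<close> factors once two are
    split off the front. The surplus last factor \<open>k - 2 * m - 1\<close> is divided out later;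
    it is nonzero since \<open>k \<le> m\<close>.\<close>
  have "pochhammer (- 2 * of_nat (Suc m) :: 'a) (Suc (Suc k)) =
      (- 2 * of_nat (Suc m)) * ((- 2 * of_nat (Suc m) + 1) * pochhammer (- 2 * of_nat (Suc m) + 1 + 1) k)"
    by (simp only: pochhammer_rec)
  also have "- 2 * of_nat (Suc m) + 1 + 1 = (- 2 * ?M :: 'a)"
    by simp
  also have "(- 2 * of_nat (Suc m)) * ((- 2 * of_nat (Suc m) + 1) * ?P) = 2 * (?M + 1) * (2 * ?M + 1) * ?P"
    by (simp add: algebra_simps)
  finally have "pochhammer (- 2 * of_nat (Suc m) :: 'a) (Suc k) * (- 2 * of_nat (Suc m) + of_nat (Suc k))
      = 2 * (?M + 1) * (2 * ?M + 1) * ?P"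
    by (simp only: pochhammer_Suc[of _ "Suc k"])
  then have prod: "pochhammer (- 2 * of_nat (Suc m) :: 'a) (Suc k) * (?K - 2 * ?M - 1)
      = 2 * (?M + 1) * (2 * ?M + 1) * ?P"
    by (simp add: algebra_simps)
  have "of_nat (2 * m + 1) \<noteq> (of_nat k :: 'a)"
    using assms by (simp only: of_nat_eq_iff)
  then have "?K - 2 * ?M - 1 \<noteq> 0"
    by (auto simp: algebra_simps)
  with prod have den: "pochhammer (- 2 * of_nat (Suc m) :: 'a) (Suc k) =
      2 * (?M + 1) * (2 * ?M + 1) * ?P / (?K - 2 * ?M - 1)"
    by (simp add: eq_divide_eq)
  have "of_nat (2 * m + 2) \<noteq> (0 :: 'a)"
    by (simp only: of_nat_eq_0_iff)
  then have "?M + 1 \<noteq> 0" and "2 + 2 * ?M \<noteq> 0"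
    by (auto simp: algebra_simps add_eq_0_iff)
  then show ?thesis
    unfolding watson_term_def num den
    unfolding pochhammer_Suc fact_Suc
    by (simp add: divide_simps del: of_nat_Suc) (simp add: algebra_simps)
qed

text \<open>The right-hand side is Gosper's antidifference at \<open>k = n + 1\<close>. Both new
  terms of the induction step are multiples of \<open>watson_term a b c m n\<close>, which leaves a
  rational identity.\<close>

lemma watson_telescope:
  fixes a b c :: "'a::field_char_0"
  assumes c: "2 * c = a + b + 1" and nz: "pochhammer c (Suc m) \<noteq> 0" and "n \<le> m"
  shows "(\<Sum>k\<le>n. watson_term a b c (Suc m) k
            - (a + 1 + 2 * of_nat m) * (b + 1 + 2 * of_nat m) / (2 * (1 + 2 * of_nat m) * (c + of_nat m))
              * watson_term a b c m k)
         = - ((a + of_nat n) * (b + of_nat n) * watson_term a b c m n)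
             / (2 * (1 + 2 * of_nat m) * (c + of_nat m))"
  using \<open>n \<le> m\<close>
proof (induction n)
  case 0
  have a: "a = 2 * c - b - 1"
    using c by (simp add: algebra_simps)
  have "1 + 2 * of_nat m \<noteq> (0::'a)"
    by (metis of_nat_Suc of_nat_mult of_nat_numeral of_nat_neq_0)
  moreover have "c + of_nat m \<noteq> 0"
    using nz by (simp add: pochhammer_Suc)
  \<comment> \<open>With \<open>x = 1 + 2 * m\<close> and \<open>2 * (c + m) = a + b + x\<close>,
    this is \<open>x * (a + b + x) - (a + x) * (b + x) = - a * b\<close>.\<close>
  ultimately show ?case
    unfolding a
    by (simp add: divide_simps del: distrib_left_numeral) (simp add: algebra_simps)
next
  case (Suc n)
  let ?M = "of_nat m :: 'a" and ?N = "of_nat n :: 'a"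
  have nM: "1 + 2 * ?M \<noteq> 0"
    by (metis of_nat_Suc of_nat_mult of_nat_numeral of_nat_neq_0)
  have nN: "1 + ?N \<noteq> 0"
    by (metis of_nat_Suc of_nat_neq_0)
  have cM: "c + ?M \<noteq> 0"
    using nz by (simp add: pochhammer_Suc)
  have "pochhammer c (Suc n) \<noteq> 0"
    using nz Suc.prems pochhammer_eq_0_mono[of c "Suc n" "Suc m"] by auto
  then have cN: "c + ?N \<noteq> 0"
    by (simp add: pochhammer_Suc)
  have "of_nat n \<noteq> (of_nat (2 * m) :: 'a)"
    using Suc.prems by (simp only: of_nat_eq_iff)
  then have NM: "?N - 2 * ?M \<noteq> 0"
    by simp
  have a: "a = 2 * c - b - 1"
    using c by (simp add: algebra_simps)
  \<comment> \<open>The induction step with the common factor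
    \<open>(a + n) * (b + n) * watson_term a b c m n\<close> removed.\<close>
  have key: "- 1 / (2 * (1 + 2 * ?M) * (c + ?M))
      + ((2 * ?M + 1 - ?N) / (2 * of_nat (Suc n) * (c + ?N) * (2 * ?M + 1))
         - (a + 1 + 2 * ?M) * (b + 1 + 2 * ?M) / (2 * (1 + 2 * ?M) * (c + ?M))
           * ((?N - ?M) / (of_nat (Suc n) * (c + ?N) * (?N - 2 * ?M))))
      = - ((a + of_nat (Suc n)) * (b + of_nat (Suc n))
             * ((?N - ?M) / (of_nat (Suc n) * (c + ?N) * (?N - 2 * ?M))))
        / (2 * (1 + 2 * ?M) * (c + ?M))"
    using nM nN cM cN NM unfolding a add.commute[of "2 * ?M" 1] of_nat_Suc
    by (simp add: divide_simps) algebra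
  \<comment> \<open>Multiplying the factor \<open>p * w\<close> back in, rather than dividing by it,
    allows it to be 0.\<close>
  have scale: "- (p * w) / d + (w * (p * u / e) - r * (w * (p * v / f))) = - (q * (w * (p * v / f))) / d"
    if "- 1 / d + (u / e - r * (v / f)) = - (q * (v / f)) / d" for p q r u v w d e f :: 'a
    using arg_cong[OF that, of "\<lambda>z. p * w * z"] by (simp add: algebra_simps)
  show ?case
    unfolding sum.atMost_Suc Suc.IH[OF Suc_leD[OF Suc.prems]]
      watson_term_Suc_Suc[OF Suc_leD[OF Suc.prems]] watson_term_Suc_right[of a b c m n]
    by (rule scale[OF key])
qed

text \<open>The telescoped sum up to \<open>m\<close> omits the last term of row
  \<open>m + 1\<close>; that term is exactly the negative of the boundary value at
  \<open>n = m\<close>, so the two cancel.\<close>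

lemma watson_sum_Suc:
  fixes a b c :: "'a::field_char_0"
  assumes c: "2 * c = a + b + 1" and nz: "pochhammer c (Suc m) \<noteq> 0"
  shows "(\<Sum>k\<le>Suc m. watson_term a b c (Suc m) k) =
     (a + 1 + 2 * of_nat m) * (b + 1 + 2 * of_nat m) / (2 * (1 + 2 * of_nat m) * (c + of_nat m))
     * (\<Sum>k\<le>m. watson_term a b c m k)"
proof -
  have "2 * of_nat m + 1 - of_nat m = (of_nat (Suc m) :: 'a)"
    by simp
  then have "watson_term a b c (Suc m) (Suc m) =
      (a + of_nat m) * (b + of_nat m) * watson_term a b c m m
        / (2 * (1 + 2 * of_nat m) * (c + of_nat m))"
    unfolding watson_term_Suc_Suc[OF order_refl]
    by (simp add: mult_ac add_ac del: of_nat_Suc distrib_left_numeral)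
  then show ?thesis
    using watson_telescope[OF c nz order_refl]
    unfolding sum_subtractf sum_distrib_left[symmetric] diff_eq_eq sum.atMost_Suc
    by (simp only:) simp
qed

theorem watson_sum:
  fixes a b c :: "'a::field_char_0"
  assumes c: "2 * c = a + b + 1" and "pochhammer c m \<noteq> 0"
  shows "(\<Sum>k\<le>m. watson_term a b c m k) =
     (pochhammer ((a + 1) / 2) m * pochhammer ((b + 1) / 2) m) /
     (pochhammer (1 / 2) m * pochhammer c m)"
  using assms(2)
proof (induction m)
  case (Suc m)
  \<comment> \<open>These are the new last factors on the right-hand side; their quotient is the
    multiplier in \<open>watson_sum_Suc\<close>.\<close>
  have half: "(x + 1) / 2 + of_nat m = (x + 1 + 2 * of_nat m) / 2"
      "1 / 2 + of_nat m = (1 + 2 * of_nat m) / (2 :: 'a)" for x :: 'a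
    by (simp_all add: field_simps)
  have "pochhammer c m \<noteq> 0"
    using Suc.prems by (auto simp: pochhammer_Suc)
  then show ?case
    unfolding watson_sum_Suc[OF c Suc.prems] Suc.IH[OF \<open>pochhammer c m \<noteq> 0\<close>] pochhammer_Suc half
    by (simp add: mult_ac del: distrib_left_numeral)
qed simp

theorem proposition1:
  fixes m :: nat and a b :: complex
  assumes "m \<ge> 1"
    and "(a + b + 1) / 2 \<notin> {- of_nat j | j. j \<le> m - 1}"
  shows "(\<Sum>k=0..m. (pochhammer a k * pochhammer b k * pochhammer (- of_nat m) k) /
            (fact k * pochhammer ((a + b + 1) / 2) k * pochhammer (- 2 * of_nat m) k))
         = (pochhammer ((a + 1) / 2) m * pochhammer ((b + 1) / 2) m) /
           (pochhammer (1 / 2) m * pochhammer ((a + b + 1) / 2) m)"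
proof -
  \<comment> \<open>The zeros of this product are \<open>- j\<close> with \<open>j < m\<close>,
    which is \<open>j \<le> m - 1\<close> since \<open>m \<ge> 1\<close>.\<close>
  have "pochhammer ((a + b + 1) / 2) m \<noteq> 0"
    using assms by (fastforce simp: pochhammer_eq_0_iff)
  then show ?thesis
    using watson_sum[of "(a + b + 1) / 2" a b m]
    by (simp add: watson_term_def atMost_atLeast0)
qed

end
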